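(* Let $n>1$ and let $X=\{x_0>x_1>\cdots>x_{n-1}\}$ be a linear Hilbert algebra with $n$ elements. Then $X$ is isomorphic to $\mathrm{LH}_n$.
   Context: An L-algebra is a set $X$ with a binary operation $\cdot$ and a distinguished element $1$ such that for all $x,y,z\in X$: $1\cdot x=x$ and $x\cdot 1=x\cdot x=1$; $(x\cdot y)\cdot(x\cdot z)=(y\cdot x)\cdot(y\cdot z)$; and $x\cdot y=y\cdot x=1$ implies $x=y$. It is partially ordered by $x\le y\iff x\cdot y=1$; it is linear if this order is total. A Hilbert algebra is an L-algebra with $x\cdot(y\cdot z)=(x\cdot y)\cdot(x\cdot z)$ for all $x,y,z$. $\mathrm{LH}_n$ is the linear Hilbert algebra on the $n$-element set $\{a_0,a_1,\dots,a_{n-1}\}$ with $1=a_0$, $a_i\cdot a_j=a_0$ if $i\ge j$, and $a_i\cdot a_j=a_j$ if $i<j$. *)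

theory Defs
  imports Main
begin

record 'a l_structure =
  carrier :: "'a set"
  lmult :: "'a \<Rightarrow> 'a \<Rightarrow> 'a" (infixr "\<cdot>\<index>" 70)
  lone :: "'a" ("\<one>\<index>")

locale L_algebra =
  fixes X (structure)
  assumes mult_closed: "\<lbrakk>x \<in> carrier X; y \<in> carrier X\<rbrakk> \<Longrightarrow> x \<cdot> y \<in> carrier X"
    and one_closed: "\<one> \<in> carrier X"
    and one_mult: "x \<in> carrier X \<Longrightarrow> \<one> \<cdot> x = x"
    and mult_one: "x \<in> carrier X \<Longrightarrow> x \<cdot> \<one> = \<one>"
    and mult_self: "x \<in> carrier X \<Longrightarrow> x \<cdot> x = \<one>"
    and cycloid: "\<lbrakk>x \<in> carrier X; y \<in> carrier X; z \<in> carrier X\<rbrakk>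
      \<Longrightarrow> (x \<cdot> y) \<cdot> (x \<cdot> z) = (y \<cdot> x) \<cdot> (y \<cdot> z)"
    and mult_antisym: "\<lbrakk>x \<in> carrier X; y \<in> carrier X; x \<cdot> y = \<one>; y \<cdot> x = \<one>\<rbrakk> \<Longrightarrow> x = y"

definition L_le :: "('a, 'b) l_structure_scheme \<Rightarrow> 'a \<Rightarrow> 'a \<Rightarrow> bool" (infix "\<preceq>\<index>" 50)
  where "x \<preceq>\<^bsub>X\<^esub> y \<longleftrightarrow> x \<cdot>\<^bsub>X\<^esub> y = \<one>\<^bsub>X\<^esub>"

definition L_less :: "('a, 'b) l_structure_scheme \<Rightarrow> 'a \<Rightarrow> 'a \<Rightarrow> bool" (infix "\<prec>\<index>" 50)
  where "x \<prec>\<^bsub>X\<^esub> y \<longleftrightarrow> x \<preceq>\<^bsub>X\<^esub> y \<and> x \<noteq> y"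

locale linear_L_algebra = L_algebra +
  assumes linear: "\<lbrakk>x \<in> carrier X; y \<in> carrier X\<rbrakk> \<Longrightarrow> x \<preceq> y \<or> y \<preceq> x"

locale Hilbert_algebra = L_algebra +
  assumes self_distrib: "\<lbrakk>x \<in> carrier X; y \<in> carrier X; z \<in> carrier X\<rbrakk>
    \<Longrightarrow> x \<cdot> (y \<cdot> z) = (x \<cdot> y) \<cdot> (x \<cdot> z)"

locale linear_Hilbert_algebra = linear_L_algebra + Hilbert_algebra

definition L_iso :: "('a, 'c) l_structure_scheme \<Rightarrow> ('b, 'd) l_structure_scheme \<Rightarrow> ('a \<Rightarrow> 'b) \<Rightarrow> bool"
  where "L_iso X Y f \<longleftrightarrow>
    bij_betw f (carrier X) (carrier Y) \<and>
    f \<one>\<^bsub>X\<^esub> = \<one>\<^bsub>Y\<^esub> \<and>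
    (\<forall>x\<in>carrier X. \<forall>y\<in>carrier X. f (x \<cdot>\<^bsub>X\<^esub> y) = f x \<cdot>\<^bsub>Y\<^esub> f y)"

definition L_isomorphic :: "('a, 'c) l_structure_scheme \<Rightarrow> ('b, 'd) l_structure_scheme \<Rightarrow> bool"
  where "L_isomorphic X Y \<longleftrightarrow> (\<exists>f. L_iso X Y f)"

text \<open>The element $a_i$ of $\mathrm{LH}_n$ is represented by its index $i$.  The algebra order is
  therefore the reverse of the usual order on indices, and the unit is the index 0.\<close>

definition LH :: "nat \<Rightarrow> nat l_structure"
  where "LH n = \<lparr>carrier = {..<n}, lmult = (\<lambda>i j. if i \<ge> j then 0 else j), lone = 0\<rparr>"

lemma LH_linear_Hilbert_algebra:
  assumes "n \<ge> 1"
  shows "linear_Hilbert_algebra (LH n)"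
  using assms by unfold_locales (auto simp: LH_def L_le_def split: if_splits)

end

theory Submission imports Defs begin

text \<open>In a linear Hilbert algebra the order determines the product: x \<le> y means that the
  product of x and y is 1, and otherwise y < x and the product is y, by
  \<open>mult_eq_right_of_less\<close>. This is exactly the multiplication table of
  \<open>LH n\<close>. Hence the decreasing enumeration, which starts at the top element 1, is an
  isomorphism from \<open>LH n\<close>, and its inverse is the required map.\<close>

lemma (in linear_Hilbert_algebra) mult_eq_right_of_less:
  assumes x: "x \<in> carrier X" and y: "y \<in> carrier X" and less: "y \<prec> x"
  shows "x \<cdot> y = y"
proof (rule mult_antisym)
  let ?z = "x \<cdot> y"
  have z: "?z \<in> carrier X" using x y by (rule mult_closed)
  have yx: "y \<cdot> x = \<one>" and "x \<noteq> y" using less by (auto simp: L_less_def L_le_def)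
  have "?z \<noteq> \<one>" using mult_antisym[OF x y _ yx] \<open>x \<noteq> y\<close> by blast
  \<comment> \<open>Since x times itself is 1, self-distributivity makes left multiplication by x
    idempotent.\<close>
  have "x \<cdot> ?z = ?z"
    using self_distrib[OF x x y] mult_self[OF x] one_mult[OF z] by simp
  \<comment> \<open>The other case of linearity, \<open>x \<preceq> ?z\<close>, would give
    \<open>?z = x \<cdot> ?z = \<one>\<close>.\<close>
  with \<open>?z \<noteq> \<one>\<close> have "?z \<cdot> x = \<one>"
    using linear[OF x z] by (auto simp: L_le_def)
  \<comment> \<open>The cycloid law now reads
    \<open>\<one> \<cdot> (?z \<cdot> y) = ?z \<cdot> ?z\<close>.\<close>
  then show "?z \<cdot> y = \<one>"
    using cycloid[OF z x y] \<open>x \<cdot> ?z = ?z\<close> one_mult[OF mult_closed[OF z y]] mult_self[OF z]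
    by simp
  show "y \<cdot> ?z = \<one>"
    using self_distrib[OF y x y] yx mult_self[OF y] one_mult[OF one_closed] by simp
qed (use x y mult_closed in auto)

text \<open>An enumeration maps indices to elements, whereas \<open>L_isomorphic X (LH n)\<close>
  asks for a map out of \<open>X\<close>. Every element of \<open>X\<close> has the form
  \<open>f a\<close>, and closure of \<open>Y\<close> lets the inverse cancel \<open>f\<close> on
  products.\<close>

lemma L_iso_inv_into:
  assumes bij: "bij_betw f (carrier Y) (carrier X)"
    and one: "f \<one>\<^bsub>Y\<^esub> = \<one>\<^bsub>X\<^esub>" "\<one>\<^bsub>Y\<^esub> \<in> carrier Y"
    and mult: "\<And>a b. \<lbrakk>a \<in> carrier Y; b \<in> carrier Y\<rbrakk> \<Longrightarrow> a \<cdot>\<^bsub>Y\<^esub> b \<in> carrier Y"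
      "\<And>a b. \<lbrakk>a \<in> carrier Y; b \<in> carrier Y\<rbrakk> \<Longrightarrow> f (a \<cdot>\<^bsub>Y\<^esub> b) = f a \<cdot>\<^bsub>X\<^esub> f b"
  shows "L_iso X Y (inv_into (carrier Y) f)"
proof -
  let ?g = "inv_into (carrier Y) f"
  have gf: "?g (f a) = a" if "a \<in> carrier Y" for a
    using bij that by (rule bij_betw_inv_into_left)
  have "?g (f a \<cdot>\<^bsub>X\<^esub> f b) = ?g (f a) \<cdot>\<^bsub>Y\<^esub> ?g (f b)" if "a \<in> carrier Y" "b \<in> carrier Y" for a b
    using that mult(2)[symmetric] by (simp add: gf mult(1))
  moreover have "?g \<one>\<^bsub>X\<^esub> = \<one>\<^bsub>Y\<^esub>"
    using gf[OF one(2)] one(1) by simp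
  moreover have "carrier X = f ` carrier Y"
    using bij by (simp add: bij_betw_def)
  ultimately show ?thesis
    using bij_betw_inv_into[OF bij] by (auto simp: L_iso_def)
qed

theorem proposition5p5:
  fixes X :: "('a, 'b) l_structure_scheme"
    and x :: "nat \<Rightarrow> 'a"
    and n :: nat
  assumes "n > 1"
    and "linear_Hilbert_algebra X"
    and "card (carrier X) = n"
    and "carrier X = x ` {..<n}"
    and "\<And>i j. \<lbrakk>i < j; j < n\<rbrakk> \<Longrightarrow> x j \<prec>\<^bsub>X\<^esub> x i"
  shows "L_isomorphic X (LH n)"
proof -
  interpret linear_Hilbert_algebra X by fact
  have mem: "x i \<in> carrier X" if "i < n" for i using that assms(4) by simp
  \<comment> \<open>The n indices have an image of n elements.\<close>
  have "inj_on x {..<n}"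
    by (rule eq_card_imp_inj_on) (use assms(3,4) in simp_all)
  then have bij: "bij_betw x (carrier (LH n)) (carrier X)"
    using assms(4) by (simp add: bij_betw_def LH_def)
  obtain k where k: "k < n" "\<one>\<^bsub>X\<^esub> = x k" using one_closed assms(4) by auto
  have x0: "x 0 = \<one>\<^bsub>X\<^esub>"
  proof (cases "k = 0")
    case False
    then have "\<one>\<^bsub>X\<^esub> \<prec>\<^bsub>X\<^esub> x 0" using assms(5)[of 0 k] k by simp
    \<comment> \<open>Nothing lies strictly above the unit: \<open>\<one> \<preceq> x 0\<close> says
      that \<open>\<one> \<cdot> x 0\<close> is 1, but this product is \<open>x 0\<close>.\<close>
    then show ?thesis using one_mult[OF mem[of 0]] assms(1) by (simp add: L_less_def L_le_def)
  qed (use k in simp)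
  have ge: "x i \<cdot>\<^bsub>X\<^esub> x j = \<one>\<^bsub>X\<^esub>" if "j \<le> i" "i < n" for i j
    using that assms(5)[of j i] mult_self[OF mem] by (cases "i = j") (auto simp: L_less_def L_le_def)
  have less: "x i \<cdot>\<^bsub>X\<^esub> x j = x j" if "i < j" "j < n" for i j
    using that mem assms(5) by (intro mult_eq_right_of_less) auto
  \<comment> \<open>\<open>ge\<close> and \<open>less\<close> match the two branches of the product
    in \<open>LH n\<close>.\<close>
  have "L_iso X (LH n) (inv_into (carrier (LH n)) x)"
    using assms(1) x0 ge less by (intro L_iso_inv_into[OF bij]) (auto simp: LH_def)
  then show ?thesis unfolding L_isomorphic_def by blast
qed

end
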